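(* Let $(r,\rho)\in\mathcal{NC}$ and let $M=\varprojlim(M_{r,\rho},\sigma_{r,\rho})$. Then $M$ is a Lelek fan.
   Context: $(r,\rho)\in\mathcal{NC}$ means: $r,\rho\in(0,\infty)$, $r<1$, $\rho>1$, and for all integers $k,\ell$, $r^k=\rho^\ell$ if and only if $k=\ell=0$. Put $L_{r,\rho}=\{(x,y)\in[0,1]^2 : y=rx\}\cup\{(x,y)\in[0,1]^2: y=\rho x\}$ and $$M_{r,\rho}=\Big\{(x_1,x_2,x_3,\ldots)\in\prod_{i=1}^\infty[0,1] : (x_i,x_{i+1})\in L_{r,\rho}\text{ for each } i\ge 1\Big\}.$$ The map $\sigma_{r,\rho}:M_{r,\rho}\to M_{r,\rho}$ is the shift $\sigma_{r,\rho}(x_1,x_2,x_3,\ldots)=(x_2,x_3,\ldots)$. For a compact metric space $X$ and continuous $f:X\to X$, $\varprojlim(X,f)=\{(x_1,x_2,\ldots)\in\prod_{i=1}^\infty X : x_i=f(x_{i+1})\text{ for each } i\ge1\}$ with the subspace topology of the product. A continuum is a non-empty compact connected metric space. A continuum is unicoherent if whenever it is the union of two subcontinua $A,B$, the set $A\cap B$ is connected; it is hereditarily unicoherent if each of its subcontinua is unicoherent. A dendroid is an arcwise connected, hereditarily unicoherent continuum. An end-point of a dendroid $X$ is a point $x\in X$ which is an end-point of every arc in $X$ that contains it; $E(X)$ is the set of end-points of $X$. A simple triod is a space homeomorphic to $([-1,1]\times\{0\})\cup(\{0\}\times[0,1])$, and its top is the point corresponding to $(0,0)$. A ramification point of a dendroid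 $X$ is a point that is the top of some simple triod in $X$. A fan is a dendroid with at most one ramification point $v$, called the top of the fan (if it exists). In a fan, $A[x,y]$ denotes the arc with end-points $x$ and $y$ if $x\neq y$, and $A[x,x]=\{x\}$. A fan $X$ with top $v$ is smooth if for every $x\in X$ and every sequence $(x_n)$ in $X$ with $x_n\to x$, we have $A[v,x_n]\to A[v,x]$ with respect to the Hausdorff metric (smoothness refers to fans having a top). A Lelek fan is a smooth fan $X$ with $\mathrm{Cl}(E(X))=X$. *)

theory Defs
  imports "HOL-Analysis.Analysis"
begin

text \<open>
  Sequences are indexed from 0, so the coordinate \<open>x\<^sub>i\<close> with \<open>i \<ge> 1\<close> of the usual
  notation is \<open>x (i - 1)\<close>. The type \<^typ>\<open>nat \<Rightarrow> 'a\<close> carries the product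
  topology, which for metric \<open>'a\<close> is induced by the metric of
  \<^theory>\<open>HOL-Analysis.Function_Metric\<close>; a set of sequences is regarded as a
  subspace of it.
\<close>

section \<open>Mahavier products and inverse limits\<close>

definition NC :: "(real \<times> real) set"
  where "NC = {(r, \<rho>). 0 < r \<and> r < 1 \<and> 1 < \<rho> \<and>
                 (\<forall>k l :: int. r powi k = \<rho> powi l \<longleftrightarrow> k = 0 \<and> l = 0)}"

definition L_rel :: "real \<Rightarrow> real \<Rightarrow> (real \<times> real) set"
  where "L_rel r \<rho> =
    {(x, y). x \<in> {0..1} \<and> y \<in> {0..1} \<and> y = r * x} \<union>
    {(x, y). x \<in> {0..1} \<and> y \<in> {0..1} \<and> y = \<rho> * x}"

definition M_prod :: "real \<Rightarrow> real \<Rightarrow> (nat \<Rightarrow> real) set"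
  where "M_prod r \<rho> = {x. (\<forall>i. x i \<in> {0..1}) \<and> (\<forall>i. (x i, x (Suc i)) \<in> L_rel r \<rho>)}"

definition shift :: "(nat \<Rightarrow> 'a) \<Rightarrow> (nat \<Rightarrow> 'a)"
  where "shift x = (\<lambda>i. x (Suc i))"

lemma shift_in_M_prod: "x \<in> M_prod r \<rho> \<Longrightarrow> shift x \<in> M_prod r \<rho>"
  by (simp add: M_prod_def shift_def)

definition inverse_limit :: "'a set \<Rightarrow> ('a \<Rightarrow> 'a) \<Rightarrow> (nat \<Rightarrow> 'a) set"
  where "inverse_limit X f = {x. (\<forall>i. x i \<in> X) \<and> (\<forall>i. x i = f (x (Suc i)))}"

section \<open>Continua and dendroids\<close>

definition continuum :: "'a::metric_space set \<Rightarrow> bool"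
  where "continuum X \<longleftrightarrow> X \<noteq> {} \<and> compact X \<and> connected X"

text \<open>
  The library's \<^const>\<open>unicoherent\<close> quantifies over relatively closed connected sets,
  possibly empty; for continua this is the usual notion.
\<close>

lemma continuum_unicoherent_iff:
  assumes "continuum X"
  shows "unicoherent X \<longleftrightarrow>
    (\<forall>A B. continuum A \<and> continuum B \<and> X = A \<union> B \<longrightarrow> connected (A \<inter> B))"
proof -
  have X: "compact X" "closed X"
    using assms by (auto simp: continuum_def compact_imp_closed)
  have "closedin (top_of_set X) A \<longleftrightarrow> A \<subseteq> X \<and> compact A" for A
    using X by (metis closedin_closed_eq closedin_compact closedin_imp_subset compact_imp_closed)
  then show ?thesis
    unfolding unicoherent_def continuum_def
    by (metis Int_empty_left Int_empty_right Un_upper1 Un_upper2 connected_empty)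
qed

definition hereditarily_unicoherent :: "'a::metric_space set \<Rightarrow> bool"
  where "hereditarily_unicoherent X \<longleftrightarrow> (\<forall>Y \<subseteq> X. continuum Y \<longrightarrow> unicoherent Y)"

definition arcwise_connected :: "'a::metric_space set \<Rightarrow> bool"
  where "arcwise_connected X \<longleftrightarrow>
    (\<forall>x\<in>X. \<forall>y\<in>X. x \<noteq> y \<longrightarrow>
      (\<exists>g. arc g \<and> path_image g \<subseteq> X \<and> pathstart g = x \<and> pathfinish g = y))"

definition dendroid :: "'a::metric_space set \<Rightarrow> bool"
  where "dendroid X \<longleftrightarrow> continuum X \<and> arcwise_connected X \<and> hereditarily_unicoherent X"

definition end_points :: "'a::metric_space set \<Rightarrow> 'a set"
  where "end_points X =
    {x \<in> X. \<forall>g. arc g \<and> path_image g \<subseteq> X \<and> x \<in> path_image g \<longrightarrow>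
       x = pathstart g \<or> x = pathfinish g}"

section \<open>Fans\<close>

definition triod_model :: "(real \<times> real) set"
  where "triod_model = {-1..1} \<times> {0} \<union> {0} \<times> {0..1}"

definition simple_triod_with_top :: "'a::metric_space set \<Rightarrow> 'a \<Rightarrow> bool"
  where "simple_triod_with_top T v \<longleftrightarrow>
    (\<exists>f g. homeomorphism triod_model T f g \<and> f (0, 0) = v)"

definition ramification_point :: "'a::metric_space set \<Rightarrow> 'a \<Rightarrow> bool"
  where "ramification_point X v \<longleftrightarrow> (\<exists>T \<subseteq> X. simple_triod_with_top T v)"

definition fan :: "'a::metric_space set \<Rightarrow> bool"
  where "fan X \<longleftrightarrow> dendroid X \<and>
    (\<forall>u v. ramification_point X u \<and> ramification_point X v \<longrightarrow> u = v)"

text \<open>In a dendroid the arc joining two distinct points is unique, so \<open>THE\<close> is well-defined.\<close>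

definition arc_between :: "'a::metric_space set \<Rightarrow> 'a \<Rightarrow> 'a \<Rightarrow> 'a set"
  where "arc_between X x y =
    (if x = y then {x}
     else (THE A. A \<subseteq> X \<and>
             (\<exists>g. arc g \<and> path_image g = A \<and> pathstart g = x \<and> pathfinish g = y)))"

text \<open>This is the Hausdorff metric on non-empty compact sets; there the suprema are bounded.\<close>

definition hausdorff_dist :: "'a::metric_space set \<Rightarrow> 'a set \<Rightarrow> real"
  where "hausdorff_dist A B = max (SUP a\<in>A. infdist a B) (SUP b\<in>B. infdist b A)"

definition smooth_fan :: "'a::metric_space set \<Rightarrow> bool"
  where "smooth_fan X \<longleftrightarrow> fan X \<and>
    (\<exists>v. ramification_point X v \<and>
      (\<forall>x\<in>X. \<forall>s. (\<forall>n. s n \<in> X) \<and> s \<longlonglongrightarrow> x \<longrightarrow>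
        (\<lambda>n. hausdorff_dist (arc_between X v (s n)) (arc_between X v x)) \<longlonglongrightarrow> 0))"

text \<open>As \<open>X\<close> is compact, the closure in the ambient space is the closure in \<open>X\<close>.\<close>

definition lelek_fan :: "'a::metric_space set \<Rightarrow> bool"
  where "lelek_fan X \<longleftrightarrow> smooth_fan X \<and> closure (end_points X) = X"

end

(*
  A point of the inverse limit M amounts to a bi-infinite sequence z in [0,1] whose consecutive
  ratios are r or \<rho>, so M is a cone over 0: its legs are the segments through 0 belonging to the
  words in {r, \<rho>}. Legs with different words are separated by a finite window of the word, whence
  a subcontinuum of M contains the segments joining any two of its points along the legs. This
  gives hereditary unicoherence, excludes triods away from 0, and identifies the arcs from 0.
  A point with some z_k = 1 is an end-point. By Kronecker's theorem the numbers r^a \<rho>^b are dense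
  in the positive reals, so every point can be changed outside a large window and rescaled slightly
  to attain the value 1; hence the end-points are dense.
*)

theory Submission
  imports Defs "HOL-Analysis.Kronecker_Approximation_Theorem"
begin

section \<open>The topology of doubly indexed families\<close>

text \<open>A finite window never determines a leg, so a subcontinuum \<open>S\<close> cannot be cut
  along a single leg. It is cut along a cylinder instead: all legs with prescribed slopes on a
  window, above a prescribed value of coordinate 0. Such a cut fails only if \<open>S\<close> has a
  point agreeing with the target \<open>q\<close> on that window, and closedness turns growing
  windows into \<open>q \<in> S\<close>. The cut separates only if some point of \<open>S\<close> is
  not above \<open>q\<close> on its leg; supplying this witness is the task in every application.

  Local structure then reduces to counting directions. Away from the origin a nondegenerate
  subcontinuum leaves a point outwards or inwards along its leg: two directions against three arms
  of a triod, and, where a coordinate equals 1, one direction against two halves of an arc.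
  Smoothness rests on scaling by factors in [0,1] being nonexpanding for the product metric. In the
  density argument the exponents count steps of an orbit that must stay in [0,1], so they have to be
  natural numbers and the descent has to precede the climb.\<close>

lemma tendsto_fun_iff:
  fixes f :: "'a \<Rightarrow> 'b \<Rightarrow> 'c::topological_space"
  shows "(f \<longlongrightarrow> l) F \<longleftrightarrow> (\<forall>i. ((\<lambda>x. f x i) \<longlongrightarrow> l i) F)"
  using limitin_componentwise[of "\<lambda>_. euclidean" UNIV f l F]
  by (simp add: euclidean_product_topology extensional_def)

text \<open>The metric is a weighted sum of truncated coordinate distances, each monotone. Used at
  both levels of a doubly indexed family, this makes scaling nonexpanding.\<close>

lemma dist_fun_mono:
  fixes x y x' y' :: "'a::countable \<Rightarrow> 'b::metric_space"
  assumes "\<And>i. dist (x i) (y i) \<le> dist (x' i) (y' i)"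
  shows "dist x y \<le> dist x' y'"
proof -
  have summable: "summable (\<lambda>n. (1/2)^n * min (dist (u (from_nat n)) (v (from_nat n))) 1)"
    for u v :: "'a \<Rightarrow> 'b"
    by (rule summable_comparison_test'[of "\<lambda>n. (1/2)^n" 0]) auto
  show ?thesis
    unfolding dist_fun_def
    by (intro suminf_le summable mult_left_mono min.mono assms) auto
qed

text \<open>Pulled back to the parameter interval, \<open>C\<close> is a connected set of reals
  containing 0 and 1. This will give uniqueness of arcs from the origin.\<close>

lemma arc_eq_connected_subset:
  fixes g :: "real \<Rightarrow> 'a::t2_space"
  assumes "arc g" "connected C" "C \<subseteq> path_image g" "pathstart g \<in> C" "pathfinish g \<in> C"
  shows "C = path_image g"
proof -
  obtain h where h: "homeomorphism {0..1} (path_image g) g h"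
    using homeomorphism_arc assms(1) by blast
  have "connected (h ` C)"
    using h assms by (meson connected_continuous_image continuous_on_subset homeomorphism_def)
  moreover have "0 \<in> h ` C" "1 \<in> h ` C"
    using h assms(4,5) by (force simp: homeomorphism_def pathstart_def pathfinish_def image_iff)+
  ultimately have "{0..1} \<subseteq> h ` C"
    by (meson connected_contains_Icc)
  moreover have "g (h c) = c" if "c \<in> C" for c
    using h assms(3) that by (auto simp: homeomorphism_def)
  ultimately have "g s \<in> C" if "s \<in> {0..1}" for s
    using that by (metis imageE subsetD)
  then have "path_image g \<subseteq> C"
    by (auto simp: path_image_def)
  with assms(3) show ?thesis
    by (rule subset_antisym)
qed

section \<open>Scaling: the cone structure\<close>

text \<open>The factor is unrestricted: factors above 1 describe positions further out on a leg,
  even beyond \<open>M\<close>.\<close>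

definition scaled :: "real \<Rightarrow> ('a \<Rightarrow> 'b \<Rightarrow> real) \<Rightarrow> 'a \<Rightarrow> 'b \<Rightarrow> real"
  where "scaled t x = (\<lambda>n i. t * x n i)"

abbreviation origin :: "'a \<Rightarrow> 'b \<Rightarrow> real"
  where "origin \<equiv> \<lambda>_ _. 0"

lemma scaled_1 [simp]: "scaled 1 x = x"
  and scaled_0 [simp]: "scaled 0 x = origin"
  and scaled_origin [simp]: "scaled t origin = origin"
  and scaled_scaled [simp]: "scaled s (scaled t x) = scaled (s * t) x"
  by (auto simp: scaled_def mult.assoc)

lemma scaled_eq_scaled_iff: "scaled s x = scaled t x \<longleftrightarrow> s = t \<or> x = origin"
  by (auto simp: scaled_def fun_eq_iff)

lemma scaled_eq_origin_iff: "scaled s x = origin \<longleftrightarrow> s = 0 \<or> x = origin"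
  by (auto simp: scaled_def fun_eq_iff)

lemma continuous_on_entry: "continuous_on A (\<lambda>x :: 'a \<Rightarrow> 'b \<Rightarrow> real. x n i)"
  by (rule continuous_on_product_then_coordinatewise[
        OF continuous_on_product_then_coordinatewise[OF continuous_on_id]])

lemma continuous_on_scaled_factor [continuous_intros]:
  assumes "continuous_on A f"
  shows "continuous_on A (\<lambda>s. scaled (f s) x)"
  unfolding scaled_def by (intro continuous_intros assms)

lemma tendsto_scaled_factor:
  assumes "(f \<longlongrightarrow> t) F"
  shows "((\<lambda>s. scaled (f s) x) \<longlongrightarrow> scaled t x) F"
  unfolding scaled_def tendsto_fun_iff by (intro allI tendsto_intros assms)

lemma dist_scaled_le:
  fixes x y :: "'a::countable \<Rightarrow> 'b::countable \<Rightarrow> real"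
  assumes "\<bar>t\<bar> \<le> 1"
  shows "dist (scaled t x) (scaled t y) \<le> dist x y"
  unfolding scaled_def using assms
  by (intro dist_fun_mono)
    (simp add: dist_real_def mult_left_le_one_le abs_mult flip: right_diff_distrib)

lemma arc_scaled:
  assumes "x \<noteq> origin" "a \<noteq> b"
  shows "arc (\<lambda>s. scaled (a + (b - a) * s) x)"
  using assms unfolding arc_def path_def inj_on_def
  by (simp add: scaled_eq_scaled_iff continuous_on_scaled_factor continuous_on_add
      continuous_on_mult_left)

section \<open>Orbits with two slopes\<close>

locale two_slopes =
  fixes r \<rho> :: real
  assumes r_pos: "0 < r" and r_less_1: "r < 1" and one_less_rho: "1 < \<rho>"
begin

abbreviation M where "M \<equiv> inverse_limit (M_prod r \<rho>) shift"

lemma mem_M_iff: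
  "X \<in> M \<longleftrightarrow> (\<forall>n i. 0 \<le> X n i \<and> X n i \<le> 1) \<and>
    (\<forall>n i. X n (Suc i) = r * X n i \<or> X n (Suc i) = \<rho> * X n i) \<and>
    (\<forall>n i. X (Suc n) (Suc i) = X n i)"
proof -
  have "(\<forall>n. X n = shift (X (Suc n))) \<longleftrightarrow> (\<forall>n i. X (Suc n) (Suc i) = X n i)"
    by (metis shift_def ext)
  then show ?thesis
    unfolding inverse_limit_def M_prod_def L_rel_def by simp blast
qed

text \<open>No upper bound is imposed: the geometric orbits used later as pieces are unbounded, and
  only the spliced result has to fit into [0,1].\<close>

definition orbit :: "(int \<Rightarrow> real) \<Rightarrow> bool"
  where "orbit z \<longleftrightarrow> (\<forall>k. z k > 0 \<and> (z (k + 1) = r * z k \<or> z (k + 1) = \<rho> * z k))"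

text \<open>On \<open>M\<close> the entry \<open>X n i\<close> depends only on \<open>i - n\<close>;
  the representative chosen has one index equal to 0.\<close>

definition coord :: "(nat \<Rightarrow> nat \<Rightarrow> real) \<Rightarrow> int \<Rightarrow> real"
  where "coord X k = X (nat (- k)) (nat k)"

definition of_orbit :: "(int \<Rightarrow> real) \<Rightarrow> nat \<Rightarrow> nat \<Rightarrow> real"
  where "of_orbit z = (\<lambda>n i. z (int i - int n))"

lemma coord_of_orbit [simp]: "coord (of_orbit z) = z"
  by (auto simp: coord_def of_orbit_def fun_eq_iff)

lemma coord_scaled [simp]: "coord (scaled t X) k = t * coord X k"
  by (simp add: coord_def scaled_def)

lemma continuous_on_coord [continuous_intros]: "continuous_on A (\<lambda>X. coord X k)"
  unfolding coord_def by (rule continuous_on_entry)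

lemma entry_eq_coord:
  assumes "X \<in> M"
  shows "X n i = coord X (int i - int n)"
proof -
  have *: "X (m + d) (j + d) = X m j" for m j d
    using assms by (induction d) (auto simp: mem_M_iff)
  show ?thesis
    using *[of 0 n "i - n"] *[of "n - i" i 0]
    by (cases "n \<le> i") (auto simp: coord_def nat_diff_distrib' simp flip: of_nat_diff)
qed

lemma M_eqI: "X \<in> M \<Longrightarrow> Y \<in> M \<Longrightarrow> (\<And>k. coord X k = coord Y k) \<Longrightarrow> X = Y"
  by (intro ext) (simp add: entry_eq_coord)

lemma tendsto_coord:
  assumes "\<And>m. X m \<in> M" "Y \<in> M" "\<And>k. (\<lambda>m. coord (X m) k) \<longlonglongrightarrow> coord Y k"
  shows "X \<longlonglongrightarrow> Y"
  unfolding tendsto_fun_iff using assms by (simp add: entry_eq_coord)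

lemma coord_bounds: "X \<in> M \<Longrightarrow> 0 \<le> coord X k \<and> coord X k \<le> 1"
  by (auto simp: mem_M_iff coord_def)

lemma coord_step:
  assumes "X \<in> M"
  shows "coord X (k + 1) = r * coord X k \<or> coord X (k + 1) = \<rho> * coord X k"
proof -
  have "X (nat (-k)) (Suc (nat k)) = r * X (nat (-k)) (nat k) \<or>
        X (nat (-k)) (Suc (nat k)) = \<rho> * X (nat (-k)) (nat k)"
    using assms unfolding mem_M_iff by blast
  moreover have "int (Suc (nat k)) - int (nat (- k)) = k + 1" "int (nat k) - int (nat (- k)) = k"
    by auto
  ultimately show ?thesis
    using assms by (simp only: entry_eq_coord)
qed

text \<open>Both slopes are nonzero, so a zero coordinate spreads in both directions and forces the
  origin.\<close>

lemma orbit_coord: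
  assumes "X \<in> M" "X \<noteq> origin"
  shows "orbit (coord X)"
proof -
  have zero_iff: "coord X (k + 1) = 0 \<longleftrightarrow> coord X k = 0" for k
    using coord_step[OF assms(1), of k] r_pos one_less_rho by auto
  have "coord X k = 0 \<longleftrightarrow> coord X 0 = 0" for k
  proof (induction k rule: int_induct[where k=0])
    case (step1 i) then show ?case using zero_iff[of i] by simp
  next
    case (step2 i) then show ?case using zero_iff[of "i - 1"] by simp
  qed simp
  then have "coord X k \<noteq> 0" for k
    using assms by (metis (full_types) ext entry_eq_coord)
  then show ?thesis
    using coord_bounds[OF assms(1)] coord_step[OF assms(1)]
    by (auto simp: orbit_def order.strict_iff_order)
qed

lemma of_orbit_in_M: "orbit z \<Longrightarrow> (\<And>k. z k \<le> 1) \<Longrightarrow> of_orbit z \<in> M"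
  unfolding mem_M_iff of_orbit_def orbit_def
  by (auto simp: less_imp_le) (metis add.commute add_diff_eq)

lemma origin_in_M: "origin \<in> M"
  by (simp add: mem_M_iff)

lemma scaled_in_M: "X \<in> M \<Longrightarrow> 0 \<le> t \<Longrightarrow> t \<le> 1 \<Longrightarrow> scaled t X \<in> M"
  unfolding mem_M_iff scaled_def by (auto simp: mult_le_one)

lemma compact_M: "compact M"
proof -
  let ?K = "PiE UNIV (\<lambda>_::nat. PiE UNIV (\<lambda>_::nat. {0..1::real}))"
  have "compact (PiE UNIV (\<lambda>_::nat. {0..1::real}))"
    using compactin_PiE[of "\<lambda>_::nat. euclidean" UNIV "\<lambda>_. {0..1::real}"]
    by (simp add: euclidean_product_topology)
  then have "compact ?K"
    using compactin_PiE[of "\<lambda>_::nat. euclidean" UNIV "\<lambda>_::nat. PiE UNIV (\<lambda>_::nat. {0..1::real})"]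
    by (simp add: euclidean_product_topology)
  moreover have "closed M"
  proof -
    have "M = {X. (\<forall>n i. 0 \<le> X n i \<and> X n i \<le> 1) \<and>
      (\<forall>n i. X n (Suc i) = r * X n i \<or> X n (Suc i) = \<rho> * X n i) \<and>
      (\<forall>n i. X (Suc n) (Suc i) = X n i)}"
      using mem_M_iff by blast
    also have "closed \<dots>"
      by (intro closed_Collect_conj closed_Collect_all closed_Collect_disj closed_Collect_eq
          closed_Collect_le continuous_intros continuous_on_entry)
    finally show ?thesis .
  qed
  moreover have "M \<subseteq> ?K"
    by (auto simp: mem_M_iff)
  ultimately show ?thesis
    by (metis compact_Int_closed inf.absorb_iff2)
qed

text \<open>Arguments along a leg need a positive factor; this adds the apex afterwards.\<close>

lemma mem_closed_if_scales:
  assumes "closed S" "\<And>t. 0 < t \<Longrightarrow> t \<le> 1 \<Longrightarrow> scaled t x \<in> S"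
  shows "origin \<in> S"
proof -
  have "(\<lambda>n. scaled (inverse (real (Suc n))) x) \<longlonglongrightarrow> scaled 0 x"
    by (intro tendsto_scaled_factor LIMSEQ_inverse_real_of_nat)
  moreover have "scaled (inverse (real (Suc n))) x \<in> S" for n
    by (rule assms(2)) (auto simp: inverse_le_1_iff)
  ultimately show ?thesis
    using closed_sequentially[OF assms(1)] by force
qed

section \<open>Subcontinua\<close>

text \<open>
  The midpoint \<open>(r + \<rho>) / 2\<close> separates the two slopes, so the sign of
  \<open>coord X (k + 1) - (r + \<rho>) / 2 * coord X k\<close> tells by an open condition which one occurs at \<open>k\<close>.
\<close>

lemma orbit_extensionality:
  assumes X: "X \<in> M" "X \<noteq> origin" and Y: "Y \<in> M" "Y \<noteq> origin"
    and k: "k \<in> {- N..N}" and N: "0 \<le> N"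
    and agree: "\<And>k. k \<in> {- N..<N} \<Longrightarrow>
      (coord X (k + 1) - (r + \<rho>) / 2 * coord X k) * (coord Y (k + 1) - (r + \<rho>) / 2 * coord Y k) > 0"
  shows "coord X k * coord Y 0 = coord Y k * coord X 0"
proof -
  \<comment> \<open>A slope at \<open>k\<close> ties \<open>k\<close> to \<open>k + 1\<close>, so
    slopes on the half-open window control the coordinates up to \<open>N\<close> inclusive.\<close>
  have step: "coord X (k + 1) * coord Y k = coord Y (k + 1) * coord X k" if "k \<in> {- N..<N}" for k
  proof -
    have "coord X k > 0" "coord Y k > 0" and
      "coord X (k + 1) = r * coord X k \<or> coord X (k + 1) = \<rho> * coord X k"
      "coord Y (k + 1) = r * coord Y k \<or> coord Y (k + 1) = \<rho> * coord Y k"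
      using orbit_coord[OF X] orbit_coord[OF Y] by (auto simp: orbit_def)
    moreover have "(r - (r + \<rho>) / 2) * a < 0" "(\<rho> - (r + \<rho>) / 2) * a > 0" if "a > 0" for a
      using that r_less_1 one_less_rho by (auto intro!: mult_neg_pos)
    ultimately show ?thesis
      using agree[OF that] by (auto simp: left_diff_distrib[symmetric] zero_less_mult_iff)
  qed
  have pos: "coord X k > 0" "coord Y k > 0" for k
    using orbit_coord[OF X] orbit_coord[OF Y] by (auto simp: orbit_def)
  \<comment> \<open>Equal slopes keep this ratio constant, so it can be carried outwards from 0 in
    both directions.\<close>
  define q where "q k = coord X k / coord Y k" for k
  have q: "q (k + 1) = q k" if "k \<in> {- N..<N}" for k
    using step[OF that] pos[of k] pos[of "k + 1"] by (simp add: q_def field_simps)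
  have "q (int n) = q 0" if "int n \<le> N" for n
    using that
  proof (induction n)
    case (Suc n)
    then show ?case using q[of "int n"] by (simp add: add.commute)
  qed simp
  moreover have "q (- int n) = q 0" if "int n \<le> N" for n
    using that
  proof (induction n)
    case (Suc n)
    then show ?case using q[of "- int (Suc n)"] by simp
  qed simp
  moreover have "int (nat \<bar>k\<bar>) \<le> N"
    using k by auto
  ultimately have "q (int (nat \<bar>k\<bar>)) = q 0" "q (- int (nat \<bar>k\<bar>)) = q 0"
    by blast+
  then have "q k = q 0"
    by (cases "k \<ge> 0") simp_all
  then have "coord X k * coord Y 0 = coord X 0 * coord Y k"
    unfolding q_def using frac_eq_eq pos(2) by (metis less_irrefl)
  then show ?thesis
    by (simp only: mult.commute)
qed

text \<open>
  If a point \<open>q\<close> on the leg through \<open>scaled u q\<close> were missing from \<open>S\<close>, then near \<open>q\<close> all legs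
  would be cut at the height of \<open>q\<close>; the legs agreeing with that of \<open>q\<close> on a large window,
  above that height, would form a relatively clopen part of \<open>S\<close> avoiding \<open>y\<close>.
\<close>

lemma connected_contains_below:
  assumes S: "S \<subseteq> M" "closed S" "connected S"
    and u: "scaled u q \<in> S" "u \<ge> 1" and q: "q \<in> M" "q \<noteq> origin"
    and y: "y \<in> S" "\<And>v. v > 1 \<Longrightarrow> y \<noteq> scaled v q"
  shows "q \<in> S"
proof (rule ccontr)
  assume "q \<notin> S"
  define D where "D z k = coord z (k + 1) - (r + \<rho>) / 2 * coord z k" for z k
  have pos: "coord z k > 0" if "z \<in> M" "z \<noteq> origin" for z k
    using orbit_coord[OF that] by (auto simp: orbit_def)
  have D_nz: "D z k \<noteq> 0" if "z \<in> M" "z \<noteq> origin" for z k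
    using pos[OF that, of k] coord_step[OF that(1), of k] r_less_1 one_less_rho
    by (auto simp: D_def left_diff_distrib[symmetric])
  have D_cont: "continuous_on A (\<lambda>z. D z k)" for A k
    unfolding D_def by (intro continuous_intros)
  \<comment> \<open>\<open>y\<close> is not on the half-leg from \<open>q\<close> outwards (factor 1
    is excluded by \<open>q \<notin> S\<close>), so a slope differs or \<open>y\<close> is lower at
    coordinate 0. The index found here is fixed once and lies in every window used below.\<close>
  have y_cases: "\<exists>k. D y k * D q k < 0 \<or> coord y 0 < coord q 0"
  proof (rule ccontr)
    assume "\<not> ?thesis"
    then have *: "\<And>k. D y k * D q k \<ge> 0" "coord y 0 \<ge> coord q 0"
      by (auto simp: not_less)
    have y0: "y \<in> M" "y \<noteq> origin"
      using y(1) S(1) *(2) pos[OF q, of 0] by (auto simp: coord_def)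
    have "D y k * D q k > 0" for k
      using *(1)[of k] D_nz[OF y0, of k] D_nz[OF q, of k] by (simp add: order.strict_iff_order)
    then have "coord y k * coord q 0 = coord q k * coord y 0" for k
      using orbit_extensionality[OF y0 q, of k "\<bar>k\<bar>"] by (auto simp: D_def abs_if)
    then have y_eq: "coord y k = coord y 0 / coord q 0 * coord q k" for k
      using pos[OF q, of 0] by (simp add: field_simps)
    have "y = scaled (coord y 0 / coord q 0) q"
    proof (intro ext)
      fix n i show "y n i = scaled (coord y 0 / coord q 0) q n i"
        using y_eq[of "int i - int n"]
        by (simp add: entry_eq_coord[OF y0(1)] entry_eq_coord[OF q(1)] scaled_def)
    qed
    moreover have "coord y 0 / coord q 0 \<ge> 1"
      using *(2) pos[OF q, of 0] by simp
    ultimately show False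
      using y \<open>q \<notin> S\<close> by (metis order.strict_iff_order scaled_1)
  qed
  then obtain N0 where N0: "D y N0 * D q N0 < 0 \<or> coord y 0 < coord q 0"
    by blast
  have window: "\<exists>z\<in>S. \<forall>k\<in>{- N..N}. coord z k = coord q k" if N: "N > \<bar>N0\<bar>" for N :: int
  proof (rule ccontr)
    assume none: "\<not> ?thesis"
    \<comment> \<open>A nonzero point of \<open>M\<close> outside both open sets has the slopes of
      \<open>q\<close> on the window and the same coordinate 0, hence agrees with \<open>q\<close>
      there; \<open>none\<close> excludes this in \<open>S\<close>.\<close>
    define U where "U = (\<Inter>k\<in>{- N..<N}. {z. D z k * D q k > 0}) \<inter> {z. coord z 0 > coord q 0}"
    define V where "V = (\<Union>k\<in>{- N..<N}. {z. D z k * D q k < 0}) \<union> {z. coord z 0 < coord q 0}"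
    have "open {z. D z k * D q k > 0}" "open {z. D z k * D q k < 0}" for k
      by (intro open_Collect_less continuous_on_mult continuous_on_const D_cont)+
    moreover have "open {z. coord z 0 > coord q 0}" "open {z. coord z 0 < coord q 0}"
      by (intro open_Collect_less continuous_on_const continuous_on_coord)+
    ultimately have "open U" "open V"
      unfolding U_def V_def by (auto intro!: open_Int open_Un open_INT open_UN)
    moreover have "z \<notin> V" if "z \<in> U" for z
      using that by (auto simp: U_def V_def not_less less_imp_le)
    moreover have "S \<subseteq> U \<union> V"
    proof
      fix z assume z: "z \<in> S"
      show "z \<in> U \<union> V"
      proof (rule ccontr)
        assume z': "z \<notin> U \<union> V"
        then have "coord z 0 \<ge> coord q 0"
          by (auto simp: V_def)
        then have zM: "z \<in> M" "z \<noteq> origin"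
          using z S(1) pos[OF q, of 0] by (auto simp: coord_def)
        have D_pos: "D z k * D q k > 0" if "k \<in> {- N..<N}" for k
        proof -
          have "\<not> D z k * D q k < 0"
            using z' that by (auto simp: V_def)
          moreover have "D z k * D q k \<noteq> 0"
            using D_nz[OF zM] D_nz[OF q] by simp
          ultimately show ?thesis
            by linarith
        qed
        then have "coord z 0 \<le> coord q 0"
          using z' by (auto simp: U_def not_less)
        with \<open>coord z 0 \<ge> coord q 0\<close> D_pos have "\<forall>k\<in>{- N..N}. coord z k = coord q k"
          using orbit_extensionality[OF zM q] N pos[OF q, of 0] by (auto simp: D_def)
        then show False
          using none z by blast
      qed
    qed
    moreover have "y \<in> V"
    proof -
      have "N0 \<in> {- N..<N}"
        using N by auto
      with N0 show ?thesis
        unfolding V_def by blast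
    qed
    moreover have "scaled u q \<in> U"
    proof -
      have "u \<noteq> 1"
        using u(1) \<open>q \<notin> S\<close> by auto
      with u have "u > 1"
        by simp
      moreover have "D (scaled u q) k * D q k = u * (D q k)\<^sup>2" for k
        by (simp add: D_def power2_eq_square algebra_simps)
      ultimately show ?thesis
        using D_nz[OF q] pos[OF q, of 0] by (simp add: U_def)
    qed
    ultimately show False
      using connectedD[OF S(3), of U V] u(1) y(1) by blast
  qed
  \<comment> \<open>The radius starts at \<open>\<bar>N0\<bar> + 1\<close> to meet the strict bound
    of \<open>window\<close> and grows with \<open>m\<close>, so the chosen points converge to
    \<open>q\<close>.\<close>
  have "\<exists>z\<in>S. \<forall>k\<in>{- (\<bar>N0\<bar> + 1 + int m)..\<bar>N0\<bar> + 1 + int m}. coord z k = coord q k" for m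
    by (rule window) simp
  then obtain z where z: "\<And>m. z m \<in> S"
    "\<And>m k. k \<in> {- (\<bar>N0\<bar> + 1 + int m)..\<bar>N0\<bar> + 1 + int m} \<Longrightarrow> coord (z m) k = coord q k"
    by metis
  have "z \<longlonglongrightarrow> q"
  proof (rule tendsto_coord)
    fix k
    have "\<forall>\<^sub>F m in sequentially. coord (z m) k = coord q k"
      using eventually_ge_at_top[of "nat \<bar>k\<bar>"] by eventually_elim (auto intro!: z(2))
    then show "(\<lambda>m. coord (z m) k) \<longlonglongrightarrow> coord q k"
      by (rule tendsto_eventually)
  qed (use z(1) S(1) q(1) in auto)
  then show False
    using closed_sequentially[OF S(2)] z(1) \<open>q \<notin> S\<close> by blast
qed

text \<open>Here \<open>q\<close> is \<open>scaled t x\<close>, reached from \<open>x\<close> by the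
  factor \<open>1 / t\<close>, and the lower point \<open>scaled v x\<close> is itself the witness
  not above \<open>q\<close>.\<close>

lemma scaled_mem_between:
  assumes S: "S \<subseteq> M" "closed S" "connected S"
    and "x \<in> S" "scaled v x \<in> S" "0 \<le> v" "t \<in> {v..1}"
  shows "scaled t x \<in> S"
proof (cases "x = origin \<or> t = v")
  case True
  then show ?thesis using assms(4,5) by auto
next
  case False
  then have t: "0 < t" "v < t" "t \<le> 1" "x \<noteq> origin"
    using assms by auto
  show ?thesis
  proof (rule connected_contains_below[OF S, where u = "1 / t" and y = "scaled v x"])
    show "scaled t x \<in> M"
      using t assms S(1) by (auto intro: scaled_in_M)
    fix w :: real assume "w > 1"
    with t(1) have "t < w * t"
      by simp
    with t(2) show "scaled v x \<noteq> scaled w (scaled t x)"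
      using t(4) by (simp add: scaled_eq_scaled_iff)
  qed (use t assms in \<open>auto simp: scaled_eq_origin_iff\<close>)
qed

text \<open>A point \<open>y\<close> off the leg of \<open>x\<close> is above no nonzero point of
  that leg, so it is a witness for every positive \<open>t\<close>; closedness adds the
  apex.\<close>

lemma scaled_mem_if_other_leg:
  assumes S: "S \<subseteq> M" "closed S" "connected S" and "x \<in> S" "y \<in> S"
    and no: "\<And>v. v \<in> {0..1} \<Longrightarrow> y \<noteq> scaled v x" "\<And>v. v \<in> {0..1} \<Longrightarrow> x \<noteq> scaled v y"
    and "t \<in> {0..1}"
  shows "scaled t x \<in> S"
proof -
  have x: "x \<noteq> origin"
    using no(2)[of 0] by auto
  have pos: "scaled t x \<in> S" if t: "0 < t" "t \<le> 1" for t
  proof (rule connected_contains_below[OF S, where u = "1 / t" and y = y])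
    show "scaled t x \<in> M"
      using t assms S(1) by (auto intro: scaled_in_M)
    fix w :: real assume w: "w > 1"
    show "y \<noteq> scaled w (scaled t x)"
    proof
      assume "y = scaled w (scaled t x)"
      moreover define u where "u = w * t"
      ultimately have y: "y = scaled u x"
        by simp
      have "u > 0"
        using w t by (simp add: u_def)
      then have "u > 1"
        using no(1)[of u] y by fastforce
      then have "scaled (1 / u) y = x"
        unfolding y by simp
      then show False
        using no(2)[of "1 / u"] \<open>u > 1\<close> by auto
    qed
  qed (use t x assms in \<open>auto simp: scaled_eq_origin_iff\<close>)
  then show ?thesis
    using assms(8) mem_closed_if_scales[OF S(2), of x] by (cases "t = 0") auto
qed

text \<open>The factor 0 puts the origin into the first two cases; in the third both points are
  nonzero and their segments to the origin meet only there.\<close>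

lemma leg_cases:
  fixes x y :: "nat \<Rightarrow> nat \<Rightarrow> real"
  obtains v where "v \<in> {0..1}" "y = scaled v x" | v where "v \<in> {0..1}" "x = scaled v y"
  | "\<And>v. v \<in> {0..1} \<Longrightarrow> y \<noteq> scaled v x" "\<And>v. v \<in> {0..1} \<Longrightarrow> x \<noteq> scaled v y"
  by blast

lemma connected_scaled_image: "connected ((\<lambda>t. scaled t x) ` {a..b})"
  by (intro connected_continuous_image continuous_on_scaled_factor continuous_on_id connected_Icc)

text \<open>The segments joining two points depend on the points and not on the subcontinuum, so
  \<open>S\<close> and \<open>T\<close> contain the same ones.\<close>

lemma connected_Int_subcontinua:
  assumes S: "S \<subseteq> M" "closed S" "connected S" and T: "T \<subseteq> M" "closed T" "connected T"
  shows "connected (S \<inter> T)"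
proof -
  have below: "connected_component (S \<inter> T) x (scaled v x)"
    if "x \<in> S \<inter> T" "scaled v x \<in> S \<inter> T" "v \<in> {0..1}" for x v
  proof -
    have "(\<lambda>t. scaled t x) ` {v..1} \<subseteq> S \<inter> T"
      using that scaled_mem_between[OF S, of x v] scaled_mem_between[OF T, of x v] by auto
    moreover have "x \<in> (\<lambda>t. scaled t x) ` {v..1}"
      by (rule image_eqI[of _ _ 1]) (use that in auto)
    moreover have "scaled v x \<in> (\<lambda>t. scaled t x) ` {v..1}"
      using that by auto
    ultimately show ?thesis
      unfolding connected_component_def using connected_scaled_image by blast
  qed
  show ?thesis
    unfolding connected_iff_connected_component
  proof (intro ballI)
    fix x y assume xy: "x \<in> S \<inter> T" "y \<in> S \<inter> T"
    show "connected_component (S \<inter> T) x y"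
    proof (cases rule: leg_cases[where x = x and y = y])
      case (1 v)
      then show ?thesis using below xy by blast
    next
      case (2 v)
      then show ?thesis using below xy connected_component_sym by metis
    next
      case 3
      have "scaled 0 x \<in> S \<inter> T"
        using scaled_mem_if_other_leg[OF S _ _ 3, of 0] scaled_mem_if_other_leg[OF T _ _ 3, of 0] xy
        by auto
      then have "connected_component (S \<inter> T) x origin" "connected_component (S \<inter> T) y origin"
        using below[of x 0] below[of y 0] xy by simp_all
      then show ?thesis
        by (rule connected_component_trans[OF _ connected_component_sym])
    qed
  qed
qed

section \<open>Arcwise connectedness and the dendroid property\<close>

lemma scaled_arc:
  assumes "x \<noteq> origin" "a < b"
  obtains g where "arc g" "path_image g = (\<lambda>t. scaled t x) ` {a..b}"
    "pathstart g = scaled a x" "pathfinish g = scaled b x"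
proof
  let ?g = "\<lambda>s. scaled (a + (b - a) * s) x"
  show "arc ?g"
    using assms by (simp add: arc_scaled)
  have "{a..b} = (\<lambda>s. a + (b - a) * s) ` {0..1}"
    using image_affinity_atLeastAtMost[of "b - a" a 0 1] assms by (simp add: add.commute)
  then show "path_image ?g = (\<lambda>t. scaled t x) ` {a..b}"
    by (simp add: path_image_def image_image)
qed (simp_all add: pathstart_def pathfinish_def)

lemma arcwise_connected_M: "arcwise_connected M"
proof -
  have below: "\<exists>g. arc g \<and> path_image g \<subseteq> M \<and> pathstart g = scaled v x \<and> pathfinish g = x"
    if x: "x \<in> M" "v \<in> {0..1}" "x \<noteq> scaled v x" for x v
  proof -
    have "x \<noteq> origin" "v \<noteq> 1"
      using x(3) by auto
    then obtain g where g: "arc g" "path_image g = (\<lambda>t. scaled t x) ` {v..1}"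
      "pathstart g = scaled v x" "pathfinish g = scaled 1 x"
      using scaled_arc[of x v 1] x(2) by force
    moreover have "path_image g \<subseteq> M"
      using x(1,2) by (auto simp: g(2) intro: scaled_in_M)
    ultimately show ?thesis
      by auto
  qed
  show ?thesis
    unfolding arcwise_connected_def
  proof (intro ballI impI)
    fix x y assume xy: "x \<in> M" "y \<in> M" "x \<noteq> y"
    show "\<exists>g. arc g \<and> path_image g \<subseteq> M \<and> pathstart g = x \<and> pathfinish g = y"
    proof (cases rule: leg_cases[where x = x and y = y])
      case (1 v)
      then obtain g where g: "arc g" "path_image g \<subseteq> M" "pathstart g = y" "pathfinish g = x"
        using below[of x v] xy by metis
      then show ?thesis
        by (intro exI[of _ "reversepath g"]) (auto simp: arc_reversepath)
    next
      case (2 v)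
      then show ?thesis using below[of y v] xy by metis
    next
      case 3
      have nz: "x \<noteq> origin" "y \<noteq> origin"
        using 3(1)[of 0] 3(2)[of 0] by auto
      obtain g where g: "arc g" "path_image g = (\<lambda>t. scaled t x) ` {0..1}"
        "pathstart g = origin" "pathfinish g = x"
        using scaled_arc[OF nz(1), of 0 1] by auto
      obtain h where h: "arc h" "path_image h = (\<lambda>t. scaled t y) ` {0..1}"
        "pathstart h = origin" "pathfinish h = y"
        using scaled_arc[OF nz(2), of 0 1] by auto
      \<comment> \<open>A common nonzero multiple would make one point a multiple of the other by a
        factor at most 1, since \<open>t / s\<close> or \<open>s / t\<close> is.\<close>
      have meet: "s = 0" if st: "s \<in> {0..1}" "t \<in> {0..1}" "scaled s x = scaled t y" for s t
      proof (rule ccontr)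
        assume "s \<noteq> 0"
        then have "t \<noteq> 0"
          using st(3) nz by (auto simp: scaled_eq_origin_iff)
        have eq: "x = scaled (t / s) y" "y = scaled (s / t) x"
          using arg_cong[OF st(3), of "scaled (1 / s)"] arg_cong[OF st(3), of "scaled (1 / t)"]
            \<open>s \<noteq> 0\<close> \<open>t \<noteq> 0\<close> by simp_all
        have "t / s \<in> {0..1} \<or> s / t \<in> {0..1}"
          using st \<open>s \<noteq> 0\<close> \<open>t \<noteq> 0\<close> by (auto simp: divide_le_eq_1 not_le)
        then show False
          using 3 eq by metis
      qed
      have "path_image g \<inter> path_image h \<subseteq> {origin}"
      proof
        fix z assume "z \<in> path_image g \<inter> path_image h"
        then obtain s t where "s \<in> {0..1}" "t \<in> {0..1}" "z = scaled s x" "z = scaled t y"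
          unfolding g(2) h(2) by blast
        then show "z \<in> {origin}"
          using meet[of s t] by simp
      qed
      then have "arc (reversepath g +++ h)"
        using g h by (intro arc_join) (simp_all add: arc_reversepath)
      moreover have "path_image (reversepath g +++ h) \<subseteq> M"
        using xy g h by (subst path_image_join) (auto intro: scaled_in_M)
      ultimately show ?thesis
        using g h by (intro exI[of _ "reversepath g +++ h"]) simp
    qed
  qed
qed

lemma continuum_M: "continuum M"
proof -
  have "connected M"
    unfolding connected_iff_connected_component
  proof (intro ballI)
    fix x y assume "x \<in> M" "y \<in> M"
    then have "connected_component M x y" if "x \<noteq> y"
      using arcwise_connected_M that unfolding arcwise_connected_def connected_component_def
      by (metis arc_imp_path connected_path_image pathfinish_in_path_image pathstart_in_path_image)
    then show "connected_component M x y"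
      using \<open>x \<in> M\<close> by (cases "x = y") auto
  qed
  then show ?thesis
    using compact_M origin_in_M by (auto simp: continuum_def)
qed

lemma dendroid_M: "dendroid M"
proof -
  have "unicoherent Y" if Y: "Y \<subseteq> M" "continuum Y" for Y
  proof
    fix S T assume ST: "connected S" "connected T" "Y = S \<union> T"
      and cl: "closedin (top_of_set Y) S" "closedin (top_of_set Y) T"
    have "closed Y"
      using Y(2) by (simp add: continuum_def compact_imp_closed)
    then have "closed S" "closed T"
      using cl closedin_closed_trans by blast+
    then show "connected (S \<inter> T)"
      using connected_Int_subcontinua[of S T] ST Y(1) by auto
  qed
  then show ?thesis
    using continuum_M arcwise_connected_M by (simp add: dendroid_def hereditarily_unicoherent_def)
qed

section \<open>Triods and end-points\<close>

text \<open>\<open>up\<close> and \<open>down\<close> are the only two directions in which a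
  nondegenerate subcontinuum of \<open>M\<close> can leave a point other than the origin.\<close>

definition up :: "(nat \<Rightarrow> nat \<Rightarrow> real) set \<Rightarrow> (nat \<Rightarrow> nat \<Rightarrow> real) \<Rightarrow> bool"
  where "up S q \<longleftrightarrow> (\<exists>b>1. \<forall>t\<in>{1..b}. scaled t q \<in> S)"

definition down :: "(nat \<Rightarrow> nat \<Rightarrow> real) set \<Rightarrow> (nat \<Rightarrow> nat \<Rightarrow> real) \<Rightarrow> bool"
  where "down S q \<longleftrightarrow> (\<exists>a<1. \<forall>t\<in>{a..1}. scaled t q \<in> S)"

text \<open>If \<open>e\<close> is further out on the leg of \<open>q\<close>, the segment between
  them goes up. Otherwise \<open>e\<close> is a witness not above the points just below
  \<open>q\<close>, which therefore lie in \<open>S\<close>.\<close>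

lemma up_or_down:
  assumes S: "S \<subseteq> M" "closed S" "connected S"
    and q: "q \<in> S" "q \<noteq> origin" and e: "e \<in> S" "e \<noteq> q"
  shows "up S q \<or> down S q"
proof (cases "\<exists>v>1. e = scaled v q")
  case True
  then obtain v where v: "v > 1" "e = scaled v q"
    by blast
  have "scaled t q \<in> S" if "t \<in> {1..v}" for t
  proof -
    have "scaled (t / v) e \<in> S"
    proof (rule scaled_mem_between[OF S e(1), where v = "1 / v"])
      show "t / v \<in> {1 / v..1}"
        using that v(1) by (simp add: divide_right_mono)
    qed (use v q(1) in auto)
    then show ?thesis
      using v by simp
  qed
  then show ?thesis
    using v by (auto simp: up_def)
next
  case False
  \<comment> \<open>The threshold is at least the factor of \<open>e\<close>, if there is one, so
    \<open>e\<close> is above no \<open>scaled t q\<close> with \<open>t \<ge> a\<close>; the value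
    \<open>1/2\<close> keeps it positive.\<close>
  obtain a where a: "0 < a" "a < 1" "\<And>w. e = scaled w q \<Longrightarrow> w \<le> a"
  proof (cases "\<exists>w. e = scaled w q")
    case True
    then obtain w where w: "e = scaled w q"
      by blast
    then have "w \<le> 1" "w \<noteq> 1"
      using False e(2) by (auto simp: not_less[symmetric])
    then show ?thesis
      using that[of "max w (1/2)"] w q(2) by (auto simp: scaled_eq_scaled_iff)
  qed (use that[of "1/2"] in auto)
  have "scaled t q \<in> S" if t: "t \<in> {a..1}" for t
  proof (rule connected_contains_below[OF S, where u = "1 / t" and y = e])
    fix w :: real assume "w > 1"
    with t a(1) have "t < w * t"
      by simp
    with t a(3)[of "w * t"] show "e \<noteq> scaled w (scaled t q)"
      by auto
  qed (use t a q e S(1) in \<open>auto simp: scaled_eq_origin_iff intro: scaled_in_M\<close>)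
  then show ?thesis
    using a by (auto simp: down_def)
qed

text \<open>Two pieces of one leg on the same side of \<open>q\<close> overlap;
  \<open>max a b\<close> is a factor common to both.\<close>

lemma not_both_down:
  assumes "down S q" "down T q" "S \<inter> T \<subseteq> {q}"
  shows "q = origin"
proof -
  obtain a b where "a < 1" "b < 1" "\<forall>t\<in>{a..1}. scaled t q \<in> S" "\<forall>t\<in>{b..1}. scaled t q \<in> T"
    using assms(1,2) by (auto simp: down_def)
  then have "scaled (max a b) q \<in> S \<inter> T" "max a b \<noteq> 1"
    by auto
  moreover from this have "scaled (max a b) q = scaled 1 q"
    using assms(3) by auto
  ultimately show ?thesis
    unfolding scaled_eq_scaled_iff by blast
qed

lemma not_both_up:
  assumes "up S q" "up T q" "S \<inter> T \<subseteq> {q}"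
  shows "q = origin"
proof -
  obtain a b where "a > 1" "b > 1" "\<forall>t\<in>{1..a}. scaled t q \<in> S" "\<forall>t\<in>{1..b}. scaled t q \<in> T"
    using assms(1,2) by (auto simp: up_def)
  then have "scaled (min a b) q \<in> S \<inter> T" "min a b \<noteq> 1"
    by auto
  moreover from this have "scaled (min a b) q = scaled 1 q"
    using assms(3) by auto
  ultimately show ?thesis
    unfolding scaled_eq_scaled_iff by blast
qed

text \<open>Pigeonhole: two of the three arms leave \<open>q\<close> in the same direction, although
  arms meet only in \<open>q\<close>.\<close>

lemma ramification_point_imp_origin:
  assumes "ramification_point M q"
  shows "q = origin"
proof (rule ccontr)
  assume q: "q \<noteq> origin"
  obtain T f g where T: "T \<subseteq> M" and fg: "homeomorphism triod_model T f g" and f0: "f (0, 0) = q"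
    using assms by (auto simp: ramification_point_def simple_triod_with_top_def)
  have arm: "up (f ` A) q \<or> down (f ` A) q"
    if A: "A \<subseteq> triod_model" "compact A" "connected A" "(0, 0) \<in> A" "p \<in> A" "p \<noteq> (0, 0)" for A p
  proof (rule up_or_down)
    have cont: "continuous_on A f"
      using fg A(1) by (meson continuous_on_subset homeomorphism_def)
    show "f ` A \<subseteq> M"
      using fg A(1) T by (auto simp: homeomorphism_def)
    show "closed (f ` A)"
      using cont A(2) by (simp add: compact_continuous_image compact_imp_closed)
    show "connected (f ` A)"
      using cont A(3) by (rule connected_continuous_image)
    show "q \<in> f ` A"
      using f0 A(4) by blast
    show "f p \<in> f ` A"
      using A(5) by blast
    show "f p \<noteq> q"
      using A f0 homeomorphism_apply1[OF fg] by (metis subsetD)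
  qed (rule q)
  have meet: "f ` A \<inter> f ` B \<subseteq> {q}" if "A \<subseteq> triod_model" "B \<subseteq> triod_model" "A \<inter> B = {(0, 0)}" for A B
  proof -
    have "inj_on f triod_model"
      using homeomorphism_apply1[OF fg] by (metis inj_on_inverseI)
    then have "f ` A \<inter> f ` B = f ` (A \<inter> B)"
      using that(1,2) by (rule inj_on_image_Int[symmetric])
    then show ?thesis
      using that(3) f0 by simp
  qed
  let ?A = "{0..1::real} \<times> {0::real}" and ?B = "{-1..0::real} \<times> {0::real}"
    and ?C = "{0::real} \<times> {0..1::real}"
  have sub: "?A \<subseteq> triod_model" "?B \<subseteq> triod_model" "?C \<subseteq> triod_model"
    by (auto simp: triod_model_def)
  have "up (f ` ?A) q \<or> down (f ` ?A) q"
    by (rule arm[where p = "(1, 0)"]) (use sub in \<open>auto intro!: compact_Times connected_Times\<close>)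
  moreover have "up (f ` ?B) q \<or> down (f ` ?B) q"
    by (rule arm[where p = "(-1, 0)"]) (use sub in \<open>auto intro!: compact_Times connected_Times\<close>)
  moreover have "up (f ` ?C) q \<or> down (f ` ?C) q"
    by (rule arm[where p = "(0, 1)"]) (use sub in \<open>auto intro!: compact_Times connected_Times\<close>)
  moreover have "f ` ?A \<inter> f ` ?B \<subseteq> {q}" "f ` ?A \<inter> f ` ?C \<subseteq> {q}" "f ` ?B \<inter> f ` ?C \<subseteq> {q}"
    by (intro meet sub; auto)+
  ultimately show False
    using not_both_down not_both_up q by metis
qed

text \<open>Any factor above 1 pushes coordinate \<open>j\<close> beyond 1, so \<open>up\<close> is
  impossible; an arc with \<open>e\<close> in its interior would have both halves going
  down.\<close>

lemma end_pointI:
  assumes e: "e \<in> M" "coord e j = 1"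
  shows "e \<in> end_points M"
proof -
  have nz: "e \<noteq> origin"
    using e(2) by (auto simp: coord_def)
  have not_up: "\<not> up S e" if "S \<subseteq> M" for S
  proof
    assume "up S e"
    then obtain b where "b > 1" "\<forall>t\<in>{1..b}. scaled t e \<in> S"
      by (auto simp: up_def)
    moreover from this have "scaled b e \<in> M"
      using that by auto
    ultimately show False
      using coord_bounds[of "scaled b e" j] e(2) by simp
  qed
  have "e = pathstart g \<or> e = pathfinish g"
    if g: "arc g" "path_image g \<subseteq> M" "e \<in> path_image g" for g
  proof (rule ccontr)
    assume *: "\<not> ?thesis"
    obtain t where t: "t \<in> {0..1}" "e = g t"
      using g(3) by (auto simp: path_image_def)
    have inj: "inj_on g {0..1}" and cont: "continuous_on {0..1} g"
      using g(1) by (auto simp: arc_def path_def)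
    have piece: "down (g ` {a..b}) e" if ab: "0 \<le> a" "a \<le> b" "b \<le> 1" "t \<in> {a..b}" "s \<in> {a..b}" "g s \<noteq> e"
      for a b s
    proof -
      have "continuous_on {a..b} g"
        using cont by (rule continuous_on_subset) (use ab in auto)
      then have "closed (g ` {a..b})" "connected (g ` {a..b})"
        by (auto intro: compact_imp_closed compact_continuous_image connected_continuous_image)
      moreover have "g ` {a..b} \<subseteq> M"
        using g(2) ab by (auto simp: path_image_def)
      ultimately show ?thesis
        using up_or_down[of "g ` {a..b}" e "g s"] not_up ab t(2) nz by auto
    qed
    have "down (g ` {0..t}) e"
      by (rule piece[of _ _ 0]) (use t * in \<open>auto simp: pathstart_def\<close>)
    moreover have "down (g ` {t..1}) e"
      by (rule piece[of _ _ 1]) (use t * in \<open>auto simp: pathfinish_def\<close>)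
    moreover have "g ` {0..t} \<inter> g ` {t..1} \<subseteq> {e}"
    proof -
      have "g ` {0..t} \<inter> g ` {t..1} = g ` ({0..t} \<inter> {t..1})"
        by (rule inj_on_image_Int[OF inj, symmetric]) (use t in auto)
      also have "{0..t} \<inter> {t..1} = {t}"
        using t(1) by auto
      finally show ?thesis
        using t(2) by simp
    qed
    ultimately have "e = origin"
      by (rule not_both_down)
    with nz show False ..
  qed
  then show ?thesis
    using e(1) by (auto simp: end_points_def)
qed

section \<open>Arcs from the origin and smoothness\<close>

text \<open>The image of any arc from the origin to \<open>y\<close> is a subcontinuum, so it
  contains the segment; the segment is connected and contains both ends, so it is the whole image.
  This determines the \<open>THE\<close>.\<close>

lemma arc_between_origin:
  assumes "y \<in> M"
  shows "arc_between M origin y = (\<lambda>t. scaled t y) ` {0..1}"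
proof (cases "y = origin")
  case True
  then show ?thesis
    by (simp add: arc_between_def image_constant_conv)
next
  case False
  let ?C = "(\<lambda>t. scaled t y) ` {0..1}"
  have C: "?C \<subseteq> M"
    using assms by (auto intro: scaled_in_M)
  obtain h where h: "arc h" "path_image h = ?C" "pathstart h = origin" "pathfinish h = y"
    using scaled_arc[OF False, of 0 1] by auto
  have "path_image g = ?C"
    if g: "arc g" "path_image g \<subseteq> M" "pathstart g = origin" "pathfinish g = y" for g
  proof (rule arc_eq_connected_subset[symmetric, OF g(1) connected_scaled_image])
    have "path g"
      using g(1) by (rule arc_imp_path)
    moreover have "y \<in> path_image g" "origin \<in> path_image g"
      using g(3,4) by (metis pathfinish_in_path_image pathstart_in_path_image)+
    ultimately show "?C \<subseteq> path_image g"
      using scaled_mem_between[OF g(2), of y 0]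
      by (auto simp: compact_imp_closed compact_path_image connected_path_image)
    show "pathstart g \<in> ?C"
      by (rule image_eqI[of _ _ 0]) (auto simp: g)
    show "pathfinish g \<in> ?C"
      by (rule image_eqI[of _ _ 1]) (auto simp: g)
  qed
  then have "(THE A. A \<subseteq> M \<and> (\<exists>g. arc g \<and> path_image g = A \<and> pathstart g = origin \<and> pathfinish g = y)) = ?C"
    using C h by (intro the_equality) blast+
  then show ?thesis
    using False by (auto simp: arc_between_def)
qed

text \<open>Points with equal factor \<open>t\<close> are paired, and scaling does not increase
  their distance.\<close>

lemma hausdorff_dist_legs:
  "\<bar>hausdorff_dist ((\<lambda>t. scaled t x) ` {0..1}) ((\<lambda>t. scaled t y) ` {0..1})\<bar> \<le> dist x y"
  for x y :: "nat \<Rightarrow> nat \<Rightarrow> real"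
proof -
  have le: "infdist a ((\<lambda>t. scaled t y) ` {0..1}) \<le> dist x y"
    if a: "a \<in> (\<lambda>t. scaled t x) ` {0..1}" for a x and y :: "nat \<Rightarrow> nat \<Rightarrow> real"
  proof -
    obtain t where t: "t \<in> {0..1}" "a = scaled t x"
      using a by auto
    have "infdist a ((\<lambda>t. scaled t y) ` {0..1}) \<le> dist a (scaled t y)"
      using t(1) by (intro infdist_le) auto
    also have "\<dots> \<le> dist x y"
      unfolding t(2) using t(1) by (intro dist_scaled_le) auto
    finally show ?thesis .
  qed
  have nonneg: "0 \<le> (SUP a\<in>(\<lambda>t. scaled t x) ` {0..1}. infdist a ((\<lambda>t. scaled t y) ` {0..1}))"
  proof (rule order_trans[OF infdist_nonneg])
    show "infdist (scaled 1 x) ((\<lambda>t. scaled t y) ` {0..1}) \<le>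
        (SUP a\<in>(\<lambda>t. scaled t x) ` {0..1}. infdist a ((\<lambda>t. scaled t y) ` {0..1}))"
      by (intro cSUP_upper imageI bdd_aboveI2[OF le]) simp_all
  qed
  have "(SUP a\<in>(\<lambda>t. scaled t x) ` {0..1}. infdist a ((\<lambda>t. scaled t y) ` {0..1})) \<le> dist x y"
    by (rule cSUP_least) (use le in auto)
  moreover have "(SUP a\<in>(\<lambda>t. scaled t y) ` {0..1}. infdist a ((\<lambda>t. scaled t x) ` {0..1})) \<le> dist x y"
    by (rule cSUP_least) (use le[of _ y x] in \<open>auto simp: dist_commute\<close>)
  ultimately show ?thesis
    using nonneg unfolding hausdorff_dist_def by simp
qed

end

section \<open>Density of the end-points\<close>

text \<open>After taking logarithms this is inhomogeneous Kronecker approximation in dimension one;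
  the extra work is to make both exponents natural numbers.\<close>

lemma NC_approx_1:
  assumes NC: "(r, \<rho>) \<in> NC" and s: "0 < s" "s \<le> 1" and \<delta>: "0 < \<delta>" "\<delta> < 1"
  obtains a b :: nat where "1 - \<delta> < s * r ^ a * \<rho> ^ b" "s * r ^ a * \<rho> ^ b \<le> 1"
proof -
  have r: "0 < r" "r < 1" and \<rho>: "1 < \<rho>"
    and indep: "r powi k = \<rho> powi l \<Longrightarrow> k = 0 \<and> l = 0" for k l
    using NC by (auto simp: NC_def)
  \<comment> \<open>The logarithm must land in the interval from \<open>- \<eta>\<close> to 0. The
    target \<open>\<tau>\<close> for \<open>b * \<beta> - a * \<alpha>\<close> aims at its midpoint,
    leaving the tolerance \<open>\<eta> / 2\<close>.\<close>
  define \<alpha> \<beta> \<eta> \<tau> where "\<alpha> = - ln r" and "\<beta> = ln \<rho>" and "\<eta> = - ln (1 - \<delta>)" and "\<tau> = - ln s - \<eta> / 2"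
  have pos: "\<alpha> > 0" "\<beta> > 0" "\<eta> > 0"
    using r \<rho> \<delta> by (auto simp: \<alpha>_def \<beta>_def \<eta>_def)
  \<comment> \<open>Replacing \<open>\<beta>\<close> by a large multiple gives
    \<open>\<theta> > \<tau> / \<alpha> + 1\<close>; with \<open>k > 0\<close> and an error below 1,
    hence the \<open>min\<close> with 1 below, this forces \<open>h \<ge> 0\<close>.\<close>
  obtain K :: nat where K: "\<tau> + \<alpha> < real K * \<beta>" "K > 0"
  proof -
    obtain K :: nat where "\<tau> + \<alpha> < real K * \<beta>"
      using pos reals_Archimedean3 by blast
    moreover have "real K * \<beta> \<le> real (Suc K) * \<beta>"
      using pos by simp
    ultimately show ?thesis
      using that[of "Suc K"] by linarith
  qed
  define \<theta> where "\<theta> = real K * \<beta> / \<alpha>"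
  \<comment> \<open>A rational value would give equal powers of \<open>r\<close> and
    \<open>\<rho>\<close>, with the exponent of \<open>\<rho>\<close> nonzero because
    \<open>K > 0\<close>.\<close>
  have "\<theta> \<notin> \<rat>"
  proof
    assume "\<theta> \<in> \<rat>"
    then obtain p q :: int where q: "q > 0" and \<theta>: "\<theta> = of_int p / of_int q"
      by (auto elim: Rats_cases')
    then have "of_int (q * int K) * ln \<rho> = of_int (- p) * ln r"
      using pos by (simp add: \<theta>_def \<alpha>_def \<beta>_def field_simps)
    then have "\<rho> powr of_int (q * int K) = r powr of_int (- p)"
      using r \<rho> by (simp add: powr_def)
    moreover have "\<rho> powr of_int n = \<rho> powi n" "r powr of_int n = r powi n" for n
      using r \<rho> by (simp_all add: powr_real_of_int')
    ultimately have "r powi (- p) = \<rho> powi (q * int K)"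
      by metis
    then show False
      using indep q K(2) by fastforce
  qed
  moreover have "min (\<eta> / (2 * \<alpha>)) 1 > 0"
    using pos by simp
  ultimately obtain h k
    where hk: "k > 0" "\<bar>of_int k * \<theta> - of_int h - \<tau> / \<alpha>\<bar> < min (\<eta> / (2 * \<alpha>)) 1"
    by (rule sequence_of_fractional_parts_is_dense)
  have "\<theta> > \<tau> / \<alpha> + 1"
    using divide_strict_right_mono[OF K(1) pos(1)] pos(1) by (simp add: \<theta>_def add_divide_distrib)
  moreover have "of_int k * \<theta> \<ge> \<theta>"
    using hk(1) pos mult_right_mono[of 1 "of_int k" \<theta>] by (simp add: \<theta>_def)
  ultimately have "h \<ge> 0"
    using hk(2) by linarith
  define a b where "a = nat h" and "b = nat k * K"
  have ab: "of_int h = real a" "of_int k * \<theta> = real b * \<beta> / \<alpha>"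
    using \<open>h \<ge> 0\<close> hk(1) by (simp_all add: a_def b_def \<theta>_def)
  have "\<bar>real b * \<beta> / \<alpha> - real a - \<tau> / \<alpha>\<bar> < \<eta> / (2 * \<alpha>)"
    using hk(2) unfolding ab by simp
  then have "\<bar>real b * \<beta> / \<alpha> - real a - \<tau> / \<alpha>\<bar> * \<alpha> < \<eta> / (2 * \<alpha>) * \<alpha>"
    using pos by (intro mult_strict_right_mono)
  moreover have "\<bar>real b * \<beta> / \<alpha> - real a - \<tau> / \<alpha>\<bar> * \<alpha> = \<bar>(real b * \<beta> / \<alpha> - real a - \<tau> / \<alpha>) * \<alpha>\<bar>"
    using pos by (simp add: abs_mult)
  moreover have "(real b * \<beta> / \<alpha> - real a - \<tau> / \<alpha>) * \<alpha> = real b * \<beta> - real a * \<alpha> - \<tau>"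
    using pos by (simp add: field_simps)
  moreover have "\<eta> / (2 * \<alpha>) * \<alpha> = \<eta> / 2"
    using pos by simp
  ultimately have close: "\<bar>real b * \<beta> - real a * \<alpha> - \<tau>\<bar> < \<eta> / 2"
    by simp
  have p: "s * r ^ a * \<rho> ^ b > 0"
    using s r \<rho> by simp
  have "ln (s * r ^ a * \<rho> ^ b) = ln s - real a * \<alpha> + real b * \<beta>"
    using s r \<rho> by (simp add: ln_mult ln_realpow \<alpha>_def \<beta>_def)
  then have "ln (1 - \<delta>) < ln (s * r ^ a * \<rho> ^ b)" "ln (s * r ^ a * \<rho> ^ b) \<le> 0"
    using close unfolding \<tau>_def \<eta>_def by linarith+
  then show ?thesis
    using that p \<delta> by simp
qed

context two_slopes
begin

section \<open>Splicing orbits\<close>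

definition splice :: "int \<Rightarrow> (int \<Rightarrow> real) \<Rightarrow> (int \<Rightarrow> real) \<Rightarrow> int \<Rightarrow> real"
  where "splice j z w = (\<lambda>k. if k \<le> j then z k else w k)"

lemma splice_left: "k \<le> j \<Longrightarrow> splice j z w k = z k"
  and splice_right: "z j = w j \<Longrightarrow> j \<le> k \<Longrightarrow> splice j z w k = w k"
  by (auto simp: splice_def)

text \<open>Agreement at \<open>j\<close> lets every step from \<open>k\<close> to
  \<open>k + 1\<close> be read inside a single piece.\<close>

lemma orbit_splice:
  assumes "orbit z" "orbit w" "z j = w j"
  shows "orbit (splice j z w)"
  unfolding orbit_def
proof (intro allI)
  fix k
  have "splice j z w k = z k \<and> splice j z w (k + 1) = z (k + 1) \<or>
        splice j z w k = w k \<and> splice j z w (k + 1) = w (k + 1)"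
    using assms(3) by (cases k j rule: linorder_cases) (auto simp: splice_def)
  then show "0 < splice j z w k \<and>
      (splice j z w (k + 1) = r * splice j z w k \<or> splice j z w (k + 1) = \<rho> * splice j z w k)"
    using assms(1,2) unfolding orbit_def by metis
qed

lemma powi_step:
  fixes x :: "'a::field"
  assumes "x \<noteq> 0"
  shows "x powi (k + 1 - j) = x * x powi (k - j)"
proof -
  have "k + 1 - j = k - j + 1"
    by simp
  with assms show ?thesis
    by (simp only: power_int_add_1 mult.commute simp_thms)
qed

lemma orbit_r: "c > 0 \<Longrightarrow> orbit (\<lambda>k. c * r powi (k - j))"
  and orbit_rho: "c > 0 \<Longrightarrow> orbit (\<lambda>k. c * \<rho> powi (k - j))"
  using r_pos one_less_rho unfolding orbit_def by (auto simp: powi_step)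

lemma r_powi_le: "n \<le> m \<Longrightarrow> r powi m \<le> r powi n"
  using r_pos r_less_1 by (intro power_int_decreasing) auto

lemma rho_powi_le: "n \<le> m \<Longrightarrow> \<rho> powi n \<le> \<rho> powi m"
  using one_less_rho by (intro power_int_increasing) auto

text \<open>
  Outside the window \<open>{- N..N}\<close> the point is modified: to the left it decays, to the right it
  descends by \<open>r ^ a\<close>, climbs by \<open>\<rho> ^ b\<close> to a value close to 1, and then decays. The supremum
  is thereby attained, and dividing by it gives an end-point.
\<close>

lemma end_point_near:
  assumes x: "x \<in> M" "x \<noteq> origin" and NC: "(r, \<rho>) \<in> NC" and N: "0 \<le> N" and \<delta>: "0 < \<delta>" "\<delta> < 1"
  shows "\<exists>e\<in>end_points M. \<forall>k\<in>{- N..N}. \<bar>coord e k - coord x k\<bar> \<le> \<delta>"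
proof -
  define z where "z = coord x"
  have z: "orbit z" "\<And>k. z k > 0" "\<And>k. z k \<le> 1"
    using orbit_coord[OF x] coord_bounds[OF x(1)] by (auto simp: orbit_def z_def)
  obtain a b :: nat where ab: "1 - \<delta> < z N * r ^ a * \<rho> ^ b" "z N * r ^ a * \<rho> ^ b \<le> 1"
    using NC_approx_1[OF NC z(2) z(3) \<delta>] by blast
  \<comment> \<open>Each geometric piece is normalised at a joint: \<open>L\<close> at its right end
    \<open>- N\<close>, the others at their left ends.\<close>
  define L where "L = (\<lambda>k. z (- N) * \<rho> powi (k - (- N)))"
  define D where "D = (\<lambda>k. z N * r powi (k - N))"
  define U where "U = (\<lambda>k. z N * r ^ a * \<rho> powi (k - (N + int a)))"
  define R where "R = (\<lambda>k. z N * r ^ a * \<rho> ^ b * r powi (k - (N + int a + int b)))"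
  define z1 where "z1 = splice (- N) L z"
  define z2 where "z2 = splice N z1 D"
  define z3 where "z3 = splice (N + int a) z2 U"
  define w where "w = splice (N + int a + int b) z3 R"
  have glue1: "L (- N) = z (- N)"
    by (simp add: L_def)
  have z1_right: "z1 k = z k" if "- N \<le> k" for k
    unfolding z1_def using glue1 that by (rule splice_right)
  have glue2: "z1 N = D N"
    using z1_right N by (simp add: D_def)
  have z2_left: "z2 k = z1 k" if "k \<le> N" for k
    unfolding z2_def using that by (rule splice_left)
  have z2_right: "z2 k = D k" if "N \<le> k" for k
    unfolding z2_def using glue2 that by (rule splice_right)
  have glue3: "z2 (N + int a) = U (N + int a)"
    using z2_right by (simp add: D_def U_def)
  have z3_left: "z3 k = z2 k" if "k \<le> N + int a" for k
    unfolding z3_def using that by (rule splice_left)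
  have z3_right: "z3 k = U k" if "N + int a \<le> k" for k
    unfolding z3_def using glue3 that by (rule splice_right)
  have glue4: "z3 (N + int a + int b) = R (N + int a + int b)"
    using z3_right by (simp add: U_def R_def)
  have w_left: "w k = z3 k" if "k \<le> N + int a + int b" for k
    unfolding w_def using that by (rule splice_left)
  have w_right: "w k = R k" if "N + int a + int b \<le> k" for k
    unfolding w_def using glue4 that by (rule splice_right)
  have pos: "z N * r ^ a > 0" "z N * r ^ a * \<rho> ^ b > 0"
    using z(2)[of N] r_pos one_less_rho by simp_all
  have "orbit L" "orbit D" "orbit U" "orbit R"
    unfolding L_def D_def U_def R_def using pos z(2) by (intro orbit_r orbit_rho; simp)+
  then have w: "orbit w"
    unfolding w_def z3_def z2_def z1_def
    using z(1) glue1 glue2 glue3 glue4 unfolding z3_def z2_def z1_def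
    by (intro orbit_splice)
  have w_window: "w k = z k" if "k \<in> {- N..N}" for k
    using that w_left z3_left z2_left z1_right by simp
  have w_end: "w (N + int a + int b) = z N * r ^ a * \<rho> ^ b"
    using w_right by (simp add: R_def)
  have w_far_left: "w k \<le> w (- N)" if "k \<le> - N" for k
  proof -
    have "w k = L k"
      using that N w_left z3_left z2_left by (simp add: z1_def splice_left)
    also have "\<dots> \<le> z (- N)"
      using rho_powi_le[of "k - (- N)" 0] that z(2)[of "- N"] by (simp add: L_def)
    also have "\<dots> = w (- N)"
      using w_window N by simp
    finally show ?thesis .
  qed
  have w_far_right: "w k \<le> w (N + int a + int b)" if "N + int a + int b \<le> k" for k
  proof -
    have "R k \<le> z N * r ^ a * \<rho> ^ b"
      unfolding R_def using r_powi_le[of 0 "k - (N + int a + int b)"] that pos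
      by (intro mult_left_le) simp_all
    then show ?thesis
      using w_right[OF that] w_end by simp
  qed
  \<comment> \<open>Descending before climbing bounds the detour by \<open>z N\<close> on the way
    down and by its final value on the way up.\<close>
  have w_le_1: "w k \<le> 1" if k: "k \<in> {- N..N + int a + int b}" for k
  proof -
    consider "k \<in> {- N..N}" | "k \<in> {N..N + int a}" | "k \<in> {N + int a..N + int a + int b}"
      using k by fastforce
    then show ?thesis
    proof cases
      case 1
      then show ?thesis using w_window z(3) by simp
    next
      case 2
      then have "w k = D k"
        using w_left z3_left z2_right by simp
      also have "\<dots> \<le> z N"
        using r_powi_le[of 0 "k - N"] 2 z(2)[of N] by (simp add: D_def)
      finally show ?thesis
        using z(3)[of N] by simp
    next
      case 3
      then have "w k = U k"
        using w_left z3_right by simp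
      also have "\<dots> \<le> z N * r ^ a * \<rho> powi int b"
        unfolding U_def using rho_powi_le[of "k - (N + int a)" "int b"] 3 pos
        by (intro mult_left_mono) auto
      finally show ?thesis
        using ab by simp
    qed
  qed
  let ?I = "{- N..N + int a + int b}"
  have ne: "w ` ?I \<noteq> {}" "finite (w ` ?I)"
    using N by auto
  define c where "c = Max (w ` ?I)"
  obtain j where j: "j \<in> ?I" "c = w j"
    using Max_in[OF ne(2,1)] by (auto simp: c_def)
  have c_ge: "w k \<le> c" if "k \<in> ?I" for k
    unfolding c_def using ne that by (intro Max_ge) auto
  have c_ge': "w k \<le> c" for k
  proof -
    consider "k \<in> ?I" | "k \<le> - N" | "N + int a + int b \<le> k"
      by fastforce
    then show ?thesis
      using c_ge w_far_left[of k] w_far_right[of k] c_ge[of "- N"] c_ge[of "N + int a + int b"] N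
      by cases (auto intro: order_trans)
  qed
  have c: "1 - \<delta> < c" "c \<le> 1" "c > 0"
    using c_ge[of "N + int a + int b"] ab w_end w_le_1[OF j(1)] j N \<delta> by auto
  define e where "e = of_orbit (\<lambda>k. w k / c)"
  have "orbit (\<lambda>k. w k / c)"
    using w c(3) by (auto simp: orbit_def)
  then have "e \<in> M"
    unfolding e_def using c_ge' c(3) by (intro of_orbit_in_M) simp_all
  moreover have "coord e j = 1"
    using c(3) j(2) by (simp add: e_def)
  ultimately have "e \<in> end_points M"
    by (rule end_pointI)
  moreover have "\<bar>coord e k - coord x k\<bar> \<le> \<delta>" if "k \<in> {- N..N}" for k
  proof -
    \<comment> \<open>Since \<open>w k / c\<close> is at most 1, rescaling moves a coordinate by at
      most \<open>1 - c\<close>, which is below \<open>\<delta>\<close>.\<close>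
    have "coord e k - coord x k = w k / c * (1 - c)"
      using w_window[OF that] c(3) by (simp add: e_def z_def field_simps)
    moreover have "0 \<le> w k / c" "w k / c \<le> 1"
      using w_window[OF that] z(2)[of k] c_ge'[of k] c(3) by simp_all
    moreover from this have "w k / c * (1 - c) \<le> 1 - c" "0 \<le> w k / c * (1 - c)"
      using c(2) by (simp_all only: mult_left_le_one_le diff_ge_0_iff_ge mult_nonneg_nonneg)
    ultimately show ?thesis
      using c(1) by linarith
  qed
  ultimately show ?thesis
    by blast
qed

section \<open>A triod at the origin\<close>

text \<open>The orbit climbs to its peak value 1 at \<open>j\<close> and descends afterwards;
  different peaks give explicit different legs.\<close>

definition tip :: "int \<Rightarrow> nat \<Rightarrow> nat \<Rightarrow> real"
  where "tip j = of_orbit (splice j (\<lambda>k. \<rho> powi (k - j)) (\<lambda>k. r powi (k - j)))"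

lemma coord_tip: "coord (tip j) k = (if k \<le> j then \<rho> powi (k - j) else r powi (k - j))"
  by (simp add: tip_def splice_def)

lemma tip_in_M: "tip j \<in> M"
  unfolding tip_def
proof (rule of_orbit_in_M)
  show "orbit (splice j (\<lambda>k. \<rho> powi (k - j)) (\<lambda>k. r powi (k - j)))"
    using orbit_r[of 1 j] orbit_rho[of 1 j] by (intro orbit_splice) simp_all
  show "splice j (\<lambda>k. \<rho> powi (k - j)) (\<lambda>k. r powi (k - j)) k \<le> 1" for k
    using r_powi_le[of 0 "k - j"] rho_powi_le[of "k - j" 0] by (simp add: splice_def)
qed

lemma tip_neq_origin: "tip j \<noteq> origin"
  using coord_tip[of j j] by (auto simp: coord_def)

lemma inj_tip: "inj tip"
proof (rule injI, rule ccontr)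
  fix i j assume eq: "tip i = tip j" and "i \<noteq> j"
  have "coord (tip i) j < 1 \<or> coord (tip j) i < 1"
  proof (cases "i < j")
    case True
    then show ?thesis
      using r_powi_le[of 1 "j - i"] r_less_1 by (simp add: coord_tip)
  next
    case False
    with \<open>i \<noteq> j\<close> show ?thesis
      using r_powi_le[of 1 "i - j"] r_less_1 by (simp add: coord_tip)
  qed
  then show False
    using eq coord_tip[of i i] coord_tip[of j j] by simp
qed

text \<open>Read at the peaks \<open>i\<close> and \<open>j\<close>, the equation gives
  \<open>s \<le> t\<close> and \<open>t \<le> s\<close>, as coordinates never exceed 1.\<close>

lemma scaled_tip_eqD:
  assumes "scaled s (tip i) = scaled t (tip j)" "0 \<le> s" "0 \<le> t"
  shows "s = t \<and> (s = 0 \<or> i = j)"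
proof -
  have eq: "s * coord (tip i) k = t * coord (tip j) k" for k
    using assms(1) coord_scaled by metis
  have "s \<le> t"
    using eq[of i] mult_left_le[of "coord (tip j) i" t] coord_bounds[OF tip_in_M] assms(3)
    by (simp add: coord_tip[of i i])
  moreover have "t \<le> s"
    using eq[of j] mult_left_le[of "coord (tip i) j" s] coord_bounds[OF tip_in_M] assms(2)
    by (simp add: coord_tip[of j j])
  ultimately have "s = t"
    by simp
  moreover have "tip i = tip j" if "s \<noteq> 0"
    using eq that \<open>s = t\<close> by (intro M_eqI tip_in_M) simp
  ultimately show ?thesis
    using inj_tip by (auto dest: injD)
qed

lemma ramification_point_origin: "ramification_point M origin"
proof -
  \<comment> \<open>Arms are numbered by the peak of the tip whose leg will be their image.\<close>
  define pt :: "int \<Rightarrow> real \<Rightarrow> real \<times> real"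
    where "pt i s = (if i = 0 then (s, 0) else if i = 1 then (- s, 0) else (0, s))" for i s
  have pt_cases: "\<exists>i\<in>{0, 1, 2}. \<exists>s\<in>{0..1}. p = pt i s" if p_in: "p \<in> triod_model" for p
  proof -
    obtain x y where p: "p = (x, y)"
      by (cases p)
    consider "y = 0" "x \<in> {0..1}" | "y = 0" "- x \<in> {0..1}" | "x = 0" "y \<in> {0..1}"
      using p_in p by (cases "0 \<le> x") (auto simp: triod_model_def)
    then show ?thesis
    proof cases
      case 1
      then show ?thesis by (intro bexI[of _ "0 :: int"] bexI[of _ x]) (auto simp: pt_def p)
    next
      case 2
      then show ?thesis by (intro bexI[of _ "1 :: int"] bexI[of _ "- x"]) (auto simp: pt_def p)
    next
      case 3
      then show ?thesis by (intro bexI[of _ "2 :: int"] bexI[of _ y]) (auto simp: pt_def p)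
    qed
  qed
  \<comment> \<open>Positive and negative parts give one continuous formula for all arms; on each
    arm only one summand can be nonzero.\<close>
  define f where "f = (\<lambda>(x, y). \<lambda>n i. max x 0 * tip 0 n i + max (- x) 0 * tip 1 n i + max y 0 * tip 2 n i)"
  have f_pt: "f (pt i s) = scaled s (tip i)" if "i \<in> {0, 1, 2}" "s \<in> {0..1}" for i s
    using that by (auto simp: f_def pt_def scaled_def)
  have "continuous_on triod_model f"
    unfolding f_def case_prod_unfold
    by (rule continuous_on_coordinatewise_then_product)+ (intro continuous_intros)
  moreover have "compact triod_model"
    unfolding triod_model_def by (intro compact_Un compact_Times) auto
  moreover have "inj_on f triod_model"
  proof (rule inj_onI)
    fix p q assume pq: "p \<in> triod_model" "q \<in> triod_model" "f p = f q"
    obtain i s where p: "i \<in> {0, 1, 2}" "s \<in> {0..1}" "p = pt i s"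
      using pt_cases pq(1) by blast
    obtain j t where q: "j \<in> {0, 1, 2}" "t \<in> {0..1}" "q = pt j t"
      using pt_cases pq(2) by blast
    have "s = t \<and> (s = 0 \<or> i = j)"
      using pq(3) p q f_pt by (intro scaled_tip_eqD) auto
    then show "p = q"
      using p(3) q(3) by (auto simp: pt_def)
  qed
  ultimately obtain g where "homeomorphism triod_model (f ` triod_model) f g"
    using homeomorphism_compact by blast
  moreover have "f ` triod_model \<subseteq> M"
  proof
    fix z assume "z \<in> f ` triod_model"
    then obtain i s where "i \<in> {0, 1, 2}" "s \<in> {0..1}" "z = f (pt i s)"
      using pt_cases by blast
    then show "z \<in> M"
      using f_pt scaled_in_M[OF tip_in_M] by simp
  qed
  moreover have "f (0, 0) = origin"
    by (simp add: f_def)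
  ultimately show ?thesis
    unfolding ramification_point_def simple_triod_with_top_def by blast
qed

lemma smooth_fan_M: "smooth_fan M"
proof -
  have "fan M"
    unfolding fan_def using dendroid_M ramification_point_imp_origin by metis
  moreover have "(\<lambda>n. hausdorff_dist (arc_between M origin (s n)) (arc_between M origin x)) \<longlonglongrightarrow> 0"
    if x: "x \<in> M" and s: "\<And>n. s n \<in> M" "s \<longlonglongrightarrow> x" for x s
  proof (rule Lim_null_comparison)
    show "(\<lambda>n. dist (s n) x) \<longlonglongrightarrow> 0"
      using s(2) by (rule iffD1[OF tendsto_dist_iff])
  qed (simp add: arc_between_origin x s(1) hausdorff_dist_legs)
  ultimately show ?thesis
    unfolding smooth_fan_def using ramification_point_origin by blast
qed

lemma closure_end_points_M:
  assumes "(r, \<rho>) \<in> NC"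
  shows "closure (end_points M) = M"
proof
  have "end_points M \<subseteq> M"
    by (auto simp: end_points_def)
  then show "closure (end_points M) \<subseteq> M"
    using compact_M by (simp add: closure_minimal compact_imp_closed)
  have nonzero: "x \<in> closure (end_points M)" if x: "x \<in> M" "x \<noteq> origin" for x
  proof -
    \<comment> \<open>The tolerance is \<open>1 / (m + 2)\<close>, so that it is below 1 already for
      \<open>m = 0\<close>.\<close>
    have "\<exists>e\<in>end_points M. \<forall>k\<in>{- int m..int m}. \<bar>coord e k - coord x k\<bar> \<le> inverse (real (Suc (Suc m)))" for m
      by (rule end_point_near[OF x assms]) (auto simp: inverse_less_1_iff)
    then obtain e where e: "\<And>m. e m \<in> end_points M"
      "\<And>m k. k \<in> {- int m..int m} \<Longrightarrow> \<bar>coord (e m) k - coord x k\<bar> \<le> inverse (real (Suc (Suc m)))"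
      by metis
    have "e \<longlonglongrightarrow> x"
    proof (rule tendsto_coord)
      show "e m \<in> M" for m
        using e(1) \<open>end_points M \<subseteq> M\<close> by blast
      fix k
      have "(\<lambda>m. coord (e m) k - coord x k) \<longlonglongrightarrow> 0"
      proof (rule Lim_null_comparison)
        show "\<forall>\<^sub>F m in sequentially. norm (coord (e m) k - coord x k) \<le> inverse (real (Suc (Suc m)))"
          using eventually_ge_at_top[of "nat \<bar>k\<bar>"] 
          by eventually_elim (unfold real_norm_def, rule e(2), auto)
        show "(\<lambda>m. inverse (real (Suc (Suc m)))) \<longlonglongrightarrow> 0"
          using LIMSEQ_inverse_real_of_nat by (rule LIMSEQ_Suc)
      qed
      then show "(\<lambda>m. coord (e m) k) \<longlonglongrightarrow> coord x k"
        by (rule LIM_zero_cancel)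
    qed (rule x(1))
    then show ?thesis
      using e(1) closure_sequential by blast
  qed
  \<comment> \<open>The origin has no word to modify; it is reached as a limit of nonzero points on
    the leg of \<open>tip 0\<close>.\<close>
  moreover have "origin \<in> closure (end_points M)"
    by (rule mem_closed_if_scales[of _ "tip 0"])
      (auto intro!: nonzero scaled_in_M tip_in_M simp: scaled_eq_origin_iff tip_neq_origin)
  ultimately show "M \<subseteq> closure (end_points M)"
    by blast
qed

end

theorem theorem5p17:
  fixes r \<rho> :: real
  assumes "(r, \<rho>) \<in> NC"
  shows "lelek_fan (inverse_limit (M_prod r \<rho>) shift)"
proof -
  interpret two_slopes r \<rho>
    using assms by unfold_locales (auto simp: NC_def)
  show ?thesis
    using smooth_fan_M closure_end_points_M[OF assms] by (simp add: lelek_fan_def)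
qed

end
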